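(* Consider the exogenous-rate lending problem with income $\theta\sim U[0,1]$ and parameters $0<d<\rho<1$. Let $R^I=\frac{\mathbb E(\Pi^{fb})}{\mathbb E(\Pi)}$ be the relative regret. Then $R^I\ge2$ for all such $(\rho,d)$, and for any $M>0$ there exist $(\rho,d)$ such that $R^I>M$.
   Context: Exogenous-rate lending problem. A consumer has a fixed income $\theta\sim F$, unknown to the lender. In each period $t=0,1,\dots$ in which the relationship is active, the lender chooses a repayment amount $y_t\ge0$ and lends $d\,y_t$ ($d$ fixed). At the end of the period the consumer repays $y_t$ if $\theta\ge y_t$; otherwise she repays nothing (default) and the relationship ends. The lender discounts at $\rho$. For a policy $\mathbf y=(y_0,y_1,\dots)$ the expected NPV is $$\Pi(\mathbf y)=\sum_{t=0}^\infty \rho^t\Big[\prod_{i=0}^{t-1}\mathbb P(\theta\ge y_i\mid \mathcal H_i)\Big]\big[\rho\,\mathbb P(\theta\ge y_t\mid\mathcal H_t)\,y_t-d\,y_t\big],$$ where $\mathcal H_t$ is the event $\theta\ge\max_{i<t}y_i$ (no information at $t=0$) and the empty product is $1$. $\mathbb E(\Pi)$ denotes the maximum of $\Pi(\mathbf y)$ over policies. $\mathbb E(\Pi^{fb})$ is the expected profit of a lender who knows $\theta$ and lends $d\theta$ in every period: $\Pi^{fb}(\theta)=\frac{\rho-d}{1-\rho}\theta$, so $\mathbb E(\Pi^{fb})=\frac{\rho-d}{2(1-\rho)}$. *)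

theory Defs
  imports "HOL-Probability.Probability"
begin

text \<open>
  Income is a real random variable \<open>\<theta>\<close> on a probability space \<open>M\<close>.  A policy is a sequence of
  repayment amounts \<open>y 0, y 1, \<dots>\<close>; \<open>\<rho>\<close> is the discount factor, and \<open>d * y t\<close> is lent
  in period \<open>t\<close>.
\<close>

definition policies :: "(nat \<Rightarrow> real) set" where
  "policies = {y. \<forall>t. 0 \<le> y t}"

text \<open>
  The history \<open>\<H>\<^sub>t\<close>, i.e. \<open>\<theta> \<ge> max {y i | i < t}\<close>, is spelled out pointwise, so that
  it is the sure event for \<open>t = 0\<close>.  \<open>cond_prob\<close> is \<open>0\<close> when \<open>\<H>\<^sub>t\<close> is null; this has no
  effect on \<open>npv\<close>, where the survival factor of period \<open>t\<close> vanishes in that case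
  (see \<open>survival_prob\<close> below).
\<close>

definition repay_prob :: "'a measure \<Rightarrow> ('a \<Rightarrow> real) \<Rightarrow> (nat \<Rightarrow> real) \<Rightarrow> nat \<Rightarrow> real" where
  "repay_prob M \<theta> y t = \<P>(\<omega> in M. \<theta> \<omega> \<ge> y t \<bar> (\<forall>i<t. \<theta> \<omega> \<ge> y i))"

definition npv :: "'a measure \<Rightarrow> ('a \<Rightarrow> real) \<Rightarrow> real \<Rightarrow> real \<Rightarrow> (nat \<Rightarrow> real) \<Rightarrow> real" where
  "npv M \<theta> \<rho> d y =
     (\<Sum>t. \<rho> ^ t * (\<Prod>i<t. repay_prob M \<theta> y i) * (\<rho> * repay_prob M \<theta> y t * y t - d * y t))"

text \<open>
  For uniform income and \<open>0 \<le> d\<close>, \<open>0 \<le> \<rho> < 1\<close> the series above converges for every policy and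
  the supremum below is a maximum: \<open>npv_summable\<close> and \<open>optimal_npv_attained\<close>.
\<close>

definition optimal_npv :: "'a measure \<Rightarrow> ('a \<Rightarrow> real) \<Rightarrow> real \<Rightarrow> real \<Rightarrow> real" where
  "optimal_npv M \<theta> \<rho> d = (SUP y\<in>policies. npv M \<theta> \<rho> d y)"

text \<open>NPV of a lender who knows that income is \<open>x\<close> and lends \<open>d * x\<close> in every period.\<close>

definition fb_npv :: "real \<Rightarrow> real \<Rightarrow> real \<Rightarrow> real" where
  "fb_npv \<rho> d x = (\<Sum>t. \<rho> ^ t * (\<rho> * x - d * x))"

definition expected_fb_npv :: "'a measure \<Rightarrow> ('a \<Rightarrow> real) \<Rightarrow> real \<Rightarrow> real \<Rightarrow> real" where
  "expected_fb_npv M \<theta> \<rho> d = (\<integral>\<omega>. fb_npv \<rho> d (\<theta> \<omega>) \<partial>M)"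

definition relative_regret :: "'a measure \<Rightarrow> ('a \<Rightarrow> real) \<Rightarrow> real \<Rightarrow> real \<Rightarrow> real" where
  "relative_regret M \<theta> \<rho> d = expected_fb_npv M \<theta> \<rho> d / optimal_npv M \<theta> \<rho> d"

abbreviation uniform01 :: "'a measure \<Rightarrow> ('a \<Rightarrow> real) \<Rightarrow> bool" where
  "uniform01 M \<theta> \<equiv> distributed M lborel \<theta> (\<lambda>x. indicator {0..1} x / measure lborel {0..1::real})"


lemma fb_npv_eq:
  assumes "0 \<le> \<rho>" "\<rho> < 1"
  shows "fb_npv \<rho> d x = (\<rho> - d) / (1 - \<rho>) * x"
proof -
  have "(\<lambda>t. \<rho> ^ t * (\<rho> * x - d * x)) sums (1 / (1 - \<rho>) * (\<rho> * x - d * x))"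
    using assms by (intro sums_mult2 geometric_sums) auto
  then show ?thesis
    unfolding fb_npv_def by (simp add: sums_iff field_simps)
qed

lemma (in prob_space) expected_fb_npv_uniform:
  assumes "uniform01 M \<theta>" "0 \<le> \<rho>" "\<rho> < 1"
  shows "expected_fb_npv M \<theta> \<rho> d = (\<rho> - d) / (2 * (1 - \<rho>))"
proof -
  have "expectation \<theta> = 1 / 2"
    using uniform_distributed_expectation[OF assms(1)] by simp
  moreover have "expected_fb_npv M \<theta> \<rho> d = (\<rho> - d) / (1 - \<rho>) * expectation \<theta>"
    using assms(2,3) by (simp add: expected_fb_npv_def fb_npv_eq)
  ultimately show ?thesis
    by (simp only:) (simp add: field_simps)
qed

lemma (in prob_space) survival_prob:
  assumes [measurable]: "\<theta> \<in> borel_measurable M"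
  shows "(\<Prod>i<t. repay_prob M \<theta> y i) = \<P>(\<omega> in M. \<forall>i<t. \<theta> \<omega> \<ge> y i)"
proof (induction t)
  case 0
  show ?case by (simp add: prob_space)
next
  case (Suc t)
  let ?S = "\<lambda>t. \<P>(\<omega> in M. \<forall>i<t. \<theta> \<omega> \<ge> y i)"
  have *: "\<P>(\<omega> in M. \<theta> \<omega> \<ge> y t \<and> (\<forall>i<t. \<theta> \<omega> \<ge> y i)) = ?S (Suc t)"
    by (intro arg_cong[where f = prob]) (auto simp: less_Suc_eq)
  have "?S (Suc t) \<le> ?S t"
    by (intro finite_measure_mono) auto
  then have "?S t = 0 \<Longrightarrow> ?S (Suc t) = 0"
    using measure_nonneg[of M] by (metis order_antisym)
  moreover have "repay_prob M \<theta> y t = ?S (Suc t) / ?S t"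
    by (simp only: repay_prob_def cond_prob_def *)
  ultimately show ?case
    by (cases "?S t = 0") (simp_all only: prod.lessThan_Suc Suc, simp_all)
qed

primrec running_max :: "(nat \<Rightarrow> real) \<Rightarrow> nat \<Rightarrow> real" where
  "running_max y 0 = 0"
| "running_max y (Suc t) = max (running_max y t) (y t)"

lemma running_max_nonneg: "0 \<le> running_max y t"
  by (induction t) auto

lemma running_max_le_iff: "running_max y t \<le> x \<longleftrightarrow> 0 \<le> x \<and> (\<forall>i<t. y i \<le> x)"
  by (induction t) (auto simp: less_Suc_eq)

lemma (in prob_space) uniform_tail:
  assumes D: "uniform01 M \<theta>" and a: "0 \<le> a"
  shows "\<P>(\<omega> in M. \<theta> \<omega> \<ge> a) = 1 - min 1 a"
proof -
  have [measurable]: "\<theta> \<in> borel_measurable M"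
    using distributed_measurable[OF D] by simp
  have "emeasure M {\<omega> \<in> space M. \<theta> \<omega> \<ge> a} = emeasure M (\<theta> -` {a..} \<inter> space M)"
    by (intro arg_cong2[where f = emeasure]) auto
  also have "\<dots> = (\<integral>\<^sup>+x. ennreal (indicator {0..1} x / measure lborel {0..1::real}) * indicator {a..} x \<partial>lborel)"
    by (rule distributed_emeasure[OF D]) auto
  also have "\<dots> = (\<integral>\<^sup>+x. indicator {a..1} x \<partial>lborel)"
    using a by (intro nn_integral_cong) (auto split: split_indicator)
  also have "\<dots> = emeasure lborel {a..1}"
    by simp
  also have "\<dots> = ennreal (1 - min 1 a)"
    by (cases "a \<le> 1") auto
  finally show ?thesis
    by (simp add: measure_def)
qed

lemma (in prob_space) uniform_survival:
  assumes D: "uniform01 M \<theta>"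
  shows "\<P>(\<omega> in M. \<forall>i<t. \<theta> \<omega> \<ge> y i) = 1 - min 1 (running_max y t)"
proof -
  have [measurable]: "\<theta> \<in> borel_measurable M"
    using distributed_measurable[OF D] by simp
  have "\<P>(\<omega> in M. \<theta> \<omega> \<ge> 0) = 1"
    using uniform_tail[OF D, of 0] by simp
  then have "AE \<omega> in M. \<theta> \<omega> \<ge> 0"
    by (subst (asm) prob_Collect_eq_1) auto
  then have "\<P>(\<omega> in M. \<forall>i<t. \<theta> \<omega> \<ge> y i) = \<P>(\<omega> in M. \<theta> \<omega> \<ge> running_max y t)"
    by (intro prob_eq_AE) (auto simp: running_max_le_iff)
  then show ?thesis
    by (simp add: uniform_tail[OF D] running_max_nonneg)
qed

definition period_profit :: "real \<Rightarrow> real \<Rightarrow> (nat \<Rightarrow> real) \<Rightarrow> nat \<Rightarrow> real" where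
  "period_profit \<rho> d y t =
     \<rho> ^ t * (\<rho> * (1 - min 1 (running_max y (Suc t))) * y t - d * (1 - min 1 (running_max y t)) * y t)"

lemma (in prob_space) npv_summand:
  assumes D: "uniform01 M \<theta>"
  shows "\<rho> ^ t * (\<Prod>i<t. repay_prob M \<theta> y i) * (\<rho> * repay_prob M \<theta> y t * y t - d * y t)
    = period_profit \<rho> d y t"
proof -
  have m: "\<theta> \<in> borel_measurable M"
    using distributed_measurable[OF D] by simp
  let ?A = "\<lambda>t. \<Prod>i<t. repay_prob M \<theta> y i"
  have A: "?A s = 1 - min 1 (running_max y s)" for s
    by (simp only: survival_prob[OF m] uniform_survival[OF D])
  have "\<rho> ^ t * ?A t * (\<rho> * repay_prob M \<theta> y t * y t - d * y t)
      = \<rho> ^ t * (\<rho> * ?A (Suc t) * y t - d * ?A t * y t)"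
    by (simp add: algebra_simps)
  then show ?thesis
    by (simp only: A period_profit_def)
qed

lemma (in prob_space) npv_uniform:
  assumes "uniform01 M \<theta>"
  shows "npv M \<theta> \<rho> d y = (\<Sum>t. period_profit \<rho> d y t)"
  by (simp only: npv_def npv_summand[OF assms])

lemma running_max_ge: "i < t \<Longrightarrow> y i \<le> running_max y t"
  using running_max_le_iff[of y t "running_max y t"] by auto

lemma period_profit_bound:
  assumes "0 \<le> d" "0 \<le> \<rho>" "0 \<le> y t" "y t \<le> 1"
  shows "\<bar>period_profit \<rho> d y t\<bar> \<le> \<rho> ^ t * (\<rho> + d)"
proof -
  let ?a = "1 - min 1 (running_max y (Suc t))" and ?b = "1 - min 1 (running_max y t)"
  have ab: "0 \<le> ?a" "?a \<le> 1" "0 \<le> ?b" "?b \<le> 1"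
    using running_max_nonneg[of y t] running_max_nonneg[of y "Suc t"] by auto
  have 1: "?a * y t \<le> 1" "?b * y t \<le> 1" "0 \<le> ?a * y t" "0 \<le> ?b * y t"
    using ab assms by (auto intro!: mult_le_one mult_nonneg_nonneg simp del: running_max.simps)
  have 2: "\<rho> * (?a * y t) \<le> \<rho>" "d * (?b * y t) \<le> d" "0 \<le> \<rho> * (?a * y t)" "0 \<le> d * (?b * y t)"
    using mult_left_mono[OF 1(1) \<open>0 \<le> \<rho>\<close>] mult_left_mono[OF 1(2) \<open>0 \<le> d\<close>] 1(3,4) assms(1,2)
    by (auto simp del: running_max.simps intro!: mult_nonneg_nonneg)
  have "\<bar>\<rho> * (?a * y t) - d * (?b * y t)\<bar> \<le> \<rho> + d"
    using 2 by linarith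
  then have "\<rho> ^ t * \<bar>\<rho> * (?a * y t) - d * (?b * y t)\<bar> \<le> \<rho> ^ t * (\<rho> + d)"
    using assms by (intro mult_left_mono) auto
  then show ?thesis
    using assms by (simp add: period_profit_def abs_mult mult.assoc del: running_max.simps)
qed

lemma period_profit_summable:
  assumes "0 \<le> d" "0 \<le> \<rho>" "\<rho> < 1" "y \<in> policies"
  shows "summable (period_profit \<rho> d y)"
proof (cases "\<forall>t. y t \<le> 1")
  case True
  show ?thesis
  proof (rule summable_comparison_test')
    show "summable (\<lambda>t. \<rho> ^ t * (\<rho> + d))"
      using assms by (intro summable_mult2 summable_geometric) auto
    show "norm (period_profit \<rho> d y t) \<le> \<rho> ^ t * (\<rho> + d)" if "0 \<le> t" for t
      using period_profit_bound assms True by (auto simp: policies_def)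
  qed
next
  case False
  then obtain k where k: "1 < y k"
    by (auto simp: not_le)
  show ?thesis
  proof (rule summable_finite)
    fix t assume "t \<notin> {..k}"
    then have "k < t" "k < Suc t" by auto
    then have "1 < running_max y t" "1 < running_max y (Suc t)"
      using k running_max_ge[of k t y] running_max_ge[of k "Suc t" y] by linarith+
    then show "period_profit \<rho> d y t = 0"
      by (simp add: period_profit_def del: running_max.simps)
  qed auto
qed

lemma (in prob_space) npv_summable:
  assumes "uniform01 M \<theta>" "0 \<le> d" "0 \<le> \<rho>" "\<rho> < 1" "y \<in> policies"
  shows "summable (\<lambda>t. \<rho> ^ t * (\<Prod>i<t. repay_prob M \<theta> y i) * (\<rho> * repay_prob M \<theta> y t * y t - d * y t))"
  using period_profit_summable[OF assms(2-)] by (simp only: npv_summand[OF assms(1)])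

lemma running_max_min1: "min 1 (running_max (\<lambda>i. min 1 (y i)) t) = min 1 (running_max y t)"
  by (induction t) (auto simp: min_def max_def split: if_splits)

lemma period_profit_min1:
  assumes "0 \<le> d" "0 \<le> \<rho>" "y \<in> policies"
  shows "period_profit \<rho> d y t \<le> period_profit \<rho> d (\<lambda>i. min 1 (y i)) t"
proof (cases "y t \<le> 1")
  case True
  then show ?thesis
    by (simp add: period_profit_def running_max_min1 del: running_max.simps)
next
  case False
  then have "min 1 (running_max y (Suc t)) = 1"
    using running_max_ge[of t "Suc t" y] by simp
  moreover have "d * (1 - min 1 (running_max y t)) * 1 \<le> d * (1 - min 1 (running_max y t)) * y t"
    using False assms(1) by (intro mult_left_mono mult_nonneg_nonneg) auto
  ultimately show ?thesis
    using False assms(2)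
    by (auto simp: period_profit_def running_max_min1 simp del: running_max.simps intro!: mult_left_mono)
qed

lemma continuous_on_running_max: "continuous_on A (\<lambda>y. running_max y t)"
  by (induction t)
     (auto intro!: continuous_intros continuous_on_subset[OF continuous_on_product_coordinates])

lemma continuous_on_period_profit: "continuous_on A (\<lambda>y. period_profit \<rho> d y t)"
  unfolding period_profit_def
  by (intro continuous_intros continuous_on_running_max
        continuous_on_subset[OF continuous_on_product_coordinates]) auto

lemma (in prob_space) npv_attains_max:
  assumes D: "uniform01 M \<theta>" and d: "0 \<le> d" "0 \<le> \<rho>" "\<rho> < 1"
  shows "\<exists>y\<in>policies. \<forall>z\<in>policies. npv M \<theta> \<rho> d z \<le> npv M \<theta> \<rho> d y"
proof -
  define K :: "(nat \<Rightarrow> real) set" where "K = PiE UNIV (\<lambda>_. {0..1})"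
  have K: "y \<in> K \<longleftrightarrow> (\<forall>t. 0 \<le> y t \<and> y t \<le> 1)" for y
    by (auto simp: K_def PiE_iff)
  have "compactin (product_topology (\<lambda>_. euclidean) UNIV) K"
    unfolding K_def by (subst compactin_PiE) auto
  then have "compact K"
    by (simp add: euclidean_product_topology)
  moreover have "(\<lambda>_. 0) \<in> K"
    by (simp add: K)
  moreover have "continuous_on K (\<lambda>y. \<Sum>t. period_profit \<rho> d y t)"
  proof (rule uniform_limit_theorem)
    show "uniform_limit K (\<lambda>n y. \<Sum>t<n. period_profit \<rho> d y t)
        (\<lambda>y. \<Sum>t. period_profit \<rho> d y t) sequentially"
    proof (rule Weierstrass_m_test)
      show "norm (period_profit \<rho> d y t) \<le> \<rho> ^ t * (\<rho> + d)" if "y \<in> K" for t y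
        using that period_profit_bound d by (auto simp: K)
      show "summable (\<lambda>t. \<rho> ^ t * (\<rho> + d))"
        using d by (intro summable_mult2 summable_geometric) auto
    qed
  qed (auto intro!: always_eventually continuous_on_sum continuous_on_period_profit)
  ultimately obtain y where y: "y \<in> K"
      "\<And>z. z \<in> K \<Longrightarrow> (\<Sum>t. period_profit \<rho> d z t) \<le> (\<Sum>t. period_profit \<rho> d y t)"
    using continuous_attains_sup[of K "\<lambda>y. \<Sum>t. period_profit \<rho> d y t"] by auto
  have "npv M \<theta> \<rho> d z \<le> npv M \<theta> \<rho> d y" if z: "z \<in> policies" for z
  proof -
    let ?z = "\<lambda>i. min 1 (z i)"
    have z': "?z \<in> K" "?z \<in> policies"
      using z by (auto simp: K policies_def)
    have "(\<Sum>t. period_profit \<rho> d z t) \<le> (\<Sum>t. period_profit \<rho> d ?z t)"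
      using period_profit_min1 period_profit_summable d z z'(2) by (intro suminf_le) auto
    also have "\<dots> \<le> (\<Sum>t. period_profit \<rho> d y t)"
      using y(2) z'(1) by blast
    finally show ?thesis
      by (simp add: npv_uniform[OF D])
  qed
  moreover have "y \<in> policies"
    using y(1) by (auto simp: K policies_def)
  ultimately show ?thesis by blast
qed

lemma (in prob_space) optimal_npv_attained:
  assumes "uniform01 M \<theta>" "0 \<le> d" "0 \<le> \<rho>" "\<rho> < 1"
  shows "\<exists>y\<in>policies. npv M \<theta> \<rho> d y = optimal_npv M \<theta> \<rho> d
           \<and> (\<forall>z\<in>policies. npv M \<theta> \<rho> d z \<le> optimal_npv M \<theta> \<rho> d)"
proof -
  obtain y where y: "y \<in> policies" "\<And>z. z \<in> policies \<Longrightarrow> npv M \<theta> \<rho> d z \<le> npv M \<theta> \<rho> d y"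
    using npv_attains_max[OF assms] by blast
  have "optimal_npv M \<theta> \<rho> d = npv M \<theta> \<rho> d y"
    unfolding optimal_npv_def using y by (intro cSup_eq_maximum) auto
  with y show ?thesis by metis
qed

end

(* Survival probabilities decrease, so period t contributes at most
   \<rho>^t * (\<rho> - d) * y (1 - y) <= \<rho>^t * (\<rho> - d) / 4, which sums to half of the expected first-best profit.
   For the unboundedness, let c be the running maximum of the repayments. Raising it from c to c'
   costs about \<rho> * c' * (c' - c) >= \<rho> * (c'^2 - c^2) / 2 in extra defaults; after discounted summation by
   parts this is a penalty \<rho> * (1 - \<rho>) * c'^2 / 2 against a gain of at most (\<rho> - d) * c'. Hence the optimal
   profit is of order (\<rho> - d)^2, whereas the first-best profit is of order \<rho> - d. *)
theory Submission
  imports Defs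
begin

section \<open>Profit of a single period\<close>

text \<open>Loans to those who default in this period are pure cost, so dropping them leaves the
  margin \<open>\<rho> - d\<close> on the survivors. Their mass is at most \<open>1 - y t\<close>,
  or zero when \<open>y t\<close> exceeds 1.\<close>

lemma period_profit_le_quarter:
  assumes "0 \<le> d" "d \<le> \<rho>" "0 \<le> y t"
  shows "period_profit \<rho> d y t \<le> \<rho> ^ t * ((\<rho> - d) / 4)"
proof -
  let ?a = "1 - min 1 (running_max y (Suc t))" and ?b = "1 - min 1 (running_max y t)"
  have ab: "0 \<le> ?a" "?a \<le> ?b"
    by auto
  have "?a * y t \<le> 1 / 4"
  proof (cases "y t \<le> 1")
    case True
    then have "?a \<le> 1 - y t"
      by auto
    then have "?a * y t \<le> (1 - y t) * y t"
      using assms(3) by (rule mult_right_mono)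
    also have "\<dots> \<le> 1 / 4"
      using zero_le_power2[of "y t - 1 / 2"] by (simp add: power2_eq_square algebra_simps)
    finally show ?thesis .
  next
    case False
    then have "?a = 0"
      by auto
    then show ?thesis
      by (simp only:)
  qed
  then have "(\<rho> - d) * (?a * y t) \<le> (\<rho> - d) * (1 / 4)"
    using assms(2) by (intro mult_left_mono) auto
  moreover have "d * (?a * y t) \<le> d * (?b * y t)"
    using ab(2) assms by (intro mult_left_mono mult_right_mono) auto
  ultimately have "\<rho> * ?a * y t - d * ?b * y t \<le> (\<rho> - d) / 4"
    by (simp add: algebra_simps del: running_max.simps)
  then show ?thesis
    using assms unfolding period_profit_def by (intro mult_left_mono) auto
qed

text \<open>The bracket is the drop of a discounted potential, half the squared capped running
  maximum, so it disappears on summation. What is left is the maximum over \<open>b\<close> of the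
  concave quadratic \<open>(\<rho> - d) * b - \<rho> * (1 - \<rho>) * b\<^sup>2 / 2\<close>.\<close>

lemma period_profit_le_telescoping:
  assumes "0 \<le> d" "d < \<rho>" "\<rho> < 1" "0 \<le> y t"
  defines "c \<equiv> \<lambda>t. min 1 (running_max y t)"
  shows "period_profit \<rho> d y t \<le> \<rho> ^ t * ((\<rho> - d)\<^sup>2 / (2 * \<rho> * (1 - \<rho>)))
           + (\<rho> ^ Suc t * (c t)\<^sup>2 / 2 - \<rho> ^ Suc (Suc t) * (c (Suc t))\<^sup>2 / 2)"
proof -
  define a b x where "a = c t" and "b = c (Suc t)" and "x = y t"
  have a: "0 \<le> a" "a \<le> 1"
    using running_max_nonneg[of y t] by (auto simp: a_def c_def)
  have b: "b = max a (min 1 x)"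
    by (auto simp: a_def b_def c_def x_def)
  have x: "0 \<le> x"
    using assms by (simp add: x_def)
  have \<rho>: "0 < \<rho>"
    using assms by linarith
  \<comment> \<open>The difference of the two sides is half of the square of
    \<open>b - a\<close>.\<close>
  have square: "(b\<^sup>2 - a\<^sup>2) / 2 \<le> b * (b - a)"
    using zero_le_power2[of "b - a"] by (simp add: power2_eq_square field_simps)
  have gain: "(\<rho> - d) * ((1 - a) * b) \<le> (\<rho> - d) * b"
    using a b x assms by (intro mult_left_mono mult_left_le_one_le) auto
  have step: "\<rho> * (1 - b) * x - d * (1 - a) * x \<le> (\<rho> - d) * b - \<rho> * ((b\<^sup>2 - a\<^sup>2) / 2)"
  proof (cases "x \<le> a")
    case True
    then have "b = a"
      using a b by simp
    moreover have "(\<rho> - d) * ((1 - a) * x) \<le> (\<rho> - d) * ((1 - a) * a)"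
      using True a assms by (intro mult_left_mono) auto
    ultimately show ?thesis
      using gain by (simp add: algebra_simps)
  next
    case False
    \<comment> \<open>A repayment above 1 is never made, so lowering it to 1 only saves on the loan.
      Hence \<open>x\<close> may be replaced by the new capped maximum \<open>b\<close>.\<close>
    have "\<rho> * (1 - b) * x - d * (1 - a) * x \<le> \<rho> * (1 - b) * b - d * (1 - a) * b"
    proof (cases "x \<le> 1")
      case True
      then show ?thesis
        using False b by simp
    next
      case x1: False
      then have "b = 1"
        using a b by simp
      moreover have "d * (1 - a) * 1 \<le> d * (1 - a) * x"
        using x1 a assms by (intro mult_left_mono) auto
      ultimately show ?thesis
        by simp
    qed
    also have "\<dots> = (\<rho> - d) * ((1 - a) * b) - \<rho> * (b * (b - a))"
      by (simp add: algebra_simps)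
    also have "\<dots> \<le> (\<rho> - d) * b - \<rho> * ((b\<^sup>2 - a\<^sup>2) / 2)"
      using gain mult_left_mono[OF square, of \<rho>] \<rho> by linarith
    finally show ?thesis .
  qed
  \<comment> \<open>Completing the square around the vertex
    \<open>b = (\<rho> - d) / k\<close>.\<close>
  have "(\<rho> - d) * b - \<rho> * (1 - \<rho>) * b\<^sup>2 / 2 \<le> (\<rho> - d)\<^sup>2 / (2 * \<rho> * (1 - \<rho>))"
  proof -
    define k where "k = \<rho> * (1 - \<rho>)"
    have k: "0 < k"
      using \<rho> assms by (simp add: k_def)
    have "0 \<le> (\<rho> - d - k * b)\<^sup>2 / (2 * k)"
      using k by simp
    also have "\<dots> = (\<rho> - d)\<^sup>2 / (2 * k) - ((\<rho> - d) * b - k * b\<^sup>2 / 2)"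
      using k by (simp add: field_simps power2_eq_square)
    finally show ?thesis
      by (simp add: k_def mult.assoc)
  qed
  \<comment> \<open>The part \<open>\<rho> * \<rho> * b\<^sup>2 / 2\<close> is carried over to the
    next period as potential; the part with factor \<open>\<rho> * (1 - \<rho>)\<close> remains to
    offset the gain.\<close>
  moreover have "(\<rho> - d) * b - \<rho> * ((b\<^sup>2 - a\<^sup>2) / 2)
      = (\<rho> - d) * b - \<rho> * (1 - \<rho>) * b\<^sup>2 / 2 + (\<rho> * a\<^sup>2 / 2 - \<rho> * \<rho> * b\<^sup>2 / 2)"
    by (simp add: field_simps)
  ultimately have "\<rho> * (1 - b) * x - d * (1 - a) * x
      \<le> (\<rho> - d)\<^sup>2 / (2 * \<rho> * (1 - \<rho>)) + (\<rho> * a\<^sup>2 / 2 - \<rho> * \<rho> * b\<^sup>2 / 2)"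
    using step by linarith
  then have "\<rho> ^ t * (\<rho> * (1 - b) * x - d * (1 - a) * x)
      \<le> \<rho> ^ t * ((\<rho> - d)\<^sup>2 / (2 * \<rho> * (1 - \<rho>)) + (\<rho> * a\<^sup>2 / 2 - \<rho> * \<rho> * b\<^sup>2 / 2))"
    using \<rho> by (intro mult_left_mono) auto
  also have "\<dots> = \<rho> ^ t * ((\<rho> - d)\<^sup>2 / (2 * \<rho> * (1 - \<rho>)))
      + (\<rho> ^ Suc t * a\<^sup>2 / 2 - \<rho> ^ Suc (Suc t) * b\<^sup>2 / 2)"
    by (simp add: algebra_simps)
  finally show ?thesis
    unfolding period_profit_def a_def b_def x_def c_def .
qed

section \<open>Total profit of a policy\<close>

lemma suminf_period_profit_le_quarter:
  assumes "0 \<le> d" "d \<le> \<rho>" "\<rho> < 1" "y \<in> policies"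
  shows "(\<Sum>t. period_profit \<rho> d y t) \<le> (\<rho> - d) / (4 * (1 - \<rho>))"
proof -
  have "(\<lambda>t. \<rho> ^ t * ((\<rho> - d) / 4)) sums (1 / (1 - \<rho>) * ((\<rho> - d) / 4))"
    using assms by (intro sums_mult2 geometric_sums) auto
  then have "(\<Sum>t. period_profit \<rho> d y t) \<le> 1 / (1 - \<rho>) * ((\<rho> - d) / 4)"
    using assms period_profit_le_quarter[of d \<rho> y]
    by (intro sums_le[OF _ summable_sums[OF period_profit_summable]]) (auto simp: policies_def)
  then show ?thesis
    by (simp add: mult.commute)
qed

text \<open>The potential \<open>u\<close> starts at 0, because the maximum of an empty history is
  0, and discounting drives it back to 0. Its drops therefore sum to 0, and the geometric series
  over \<open>?k\<close> contributes the second factor \<open>1 - \<rho>\<close> in the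
  denominator.\<close>

lemma suminf_period_profit_le_square:
  assumes "0 \<le> d" "d < \<rho>" "\<rho> < 1" "y \<in> policies"
  shows "(\<Sum>t. period_profit \<rho> d y t) \<le> (\<rho> - d)\<^sup>2 / (2 * \<rho> * (1 - \<rho>)\<^sup>2)"
proof -
  define u where "u t = \<rho> ^ Suc t * (min 1 (running_max y t))\<^sup>2 / 2" for t
  let ?k = "(\<rho> - d)\<^sup>2 / (2 * \<rho> * (1 - \<rho>))"
  have \<rho>: "0 < \<rho>"
    using assms by linarith
  have "u \<longlonglongrightarrow> 0"
  proof (rule Lim_null_comparison)
    show "(\<lambda>t. \<rho> ^ t) \<longlonglongrightarrow> 0"
      using assms \<rho> by (intro LIMSEQ_power_zero) auto
    have "norm (u t) \<le> \<rho> ^ t" for t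
    proof -
      have "(min 1 (running_max y t))\<^sup>2 \<le> 1"
        using running_max_nonneg[of y t] by (intro power_le_one) auto
      then have "\<rho> * (min 1 (running_max y t))\<^sup>2 / 2 \<le> 1"
        using mult_mono[of \<rho> 1 "(min 1 (running_max y t))\<^sup>2" 1] assms by simp
      then have "\<rho> ^ t * (\<rho> * (min 1 (running_max y t))\<^sup>2 / 2) \<le> \<rho> ^ t * 1"
        using \<rho> by (intro mult_left_mono) auto
      then show ?thesis
        using \<rho> by (simp add: u_def abs_mult mult_ac)
    qed
    then show "\<forall>\<^sub>F t in sequentially. norm (u t) \<le> \<rho> ^ t"
      by simp
  qed
  then have "(\<lambda>t. u t - u (Suc t)) sums (u 0 - 0)"
    by (rule telescope_sums')
  moreover have "u 0 = 0"
    by (simp add: u_def)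
  ultimately have "(\<lambda>t. u t - u (Suc t)) sums 0"
    by simp
  moreover have "(\<lambda>t. \<rho> ^ t * ?k) sums (1 / (1 - \<rho>) * ?k)"
    using assms by (intro sums_mult2 geometric_sums) auto
  ultimately have "(\<lambda>t. \<rho> ^ t * ?k + (u t - u (Suc t))) sums (1 / (1 - \<rho>) * ?k + 0)"
    by (intro sums_add)
  moreover have "period_profit \<rho> d y t \<le> \<rho> ^ t * ?k + (u t - u (Suc t))" for t
    using assms period_profit_le_telescoping[of d \<rho> y t]
    by (simp add: policies_def u_def del: running_max.simps)
  moreover have "summable (period_profit \<rho> d y)"
    using assms by (intro period_profit_summable) auto
  ultimately have "(\<Sum>t. period_profit \<rho> d y t) \<le> 1 / (1 - \<rho>) * ?k + 0"
    by (intro sums_le[OF _ summable_sums])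
  then show ?thesis
    by (simp add: power2_eq_square mult_ac)
qed

section \<open>Positivity of the optimal profit and bounds on the regret\<close>

lemma running_max_const: "0 \<le> x \<Longrightarrow> running_max (\<lambda>_. x) t = (if t = 0 then 0 else x)"
  by (induction t) auto

context prob_space
begin

lemma optimal_npv_le:
  assumes "uniform01 M \<theta>" "0 \<le> d" "0 \<le> \<rho>" "\<rho> < 1"
    and "\<And>y. y \<in> policies \<Longrightarrow> (\<Sum>t. period_profit \<rho> d y t) \<le> B"
  shows "optimal_npv M \<theta> \<rho> d \<le> B"
  using optimal_npv_attained[OF assms(1-4)] assms(5) by (metis npv_uniform[OF assms(1)])

text \<open>The optimum is the denominator of the regret; were it 0, the quotient would be 0 by
  convention and no lower bound could follow.\<close>

lemma optimal_npv_pos: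
  assumes D: "uniform01 M \<theta>" and "0 \<le> d" "d < \<rho>" "\<rho> < 1"
  shows "0 < optimal_npv M \<theta> \<rho> d"
proof -
  \<comment> \<open>Any constant repayment below \<open>1 - d / \<rho>\<close> is already profitable in the first period.\<close>
  define x where "x = (1 - d / \<rho>) / 2"
  have x: "0 < x" "x < 1" "d < \<rho> * (1 - x)"
    using assms by (auto simp: x_def field_simps)
  have y: "(\<lambda>_. x) \<in> policies"
    using x by (simp add: policies_def)
  have first: "0 < period_profit \<rho> d (\<lambda>_. x) 0"
    using x by (simp add: period_profit_def)
  have "0 \<le> period_profit \<rho> d (\<lambda>_. x) t" for t
  proof (cases t)
    case 0
    then show ?thesis
      using first by simp
  next
    \<comment> \<open>After period 0 everyone left has income at least \<open>x\<close>, so there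
      are no further defaults and the survivors of mass \<open>1 - x\<close> yield the margin
      \<open>\<rho> - d\<close>.\<close>
    case (Suc n)
    then have "period_profit \<rho> d (\<lambda>_. x) t = \<rho> ^ t * ((\<rho> - d) * ((1 - x) * x))"
      using x by (simp add: period_profit_def running_max_const algebra_simps del: running_max.simps)
    then show ?thesis
      using x assms by simp
  qed
  then have "0 < (\<Sum>t. period_profit \<rho> d (\<lambda>_. x) t)"
    using first assms y by (intro suminf_pos2[of _ 0] period_profit_summable) auto
  also have "\<dots> = npv M \<theta> \<rho> d (\<lambda>_. x)"
    by (simp add: npv_uniform[OF D])
  also have "\<dots> \<le> optimal_npv M \<theta> \<rho> d"
    using optimal_npv_attained[OF D, of d \<rho>] assms y by auto
  finally show ?thesis .
qed

lemma relative_regret_ge: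
  assumes D: "uniform01 M \<theta>" and "0 \<le> d" "d < \<rho>" "\<rho> < 1"
    and le: "optimal_npv M \<theta> \<rho> d \<le> B"
  shows "(\<rho> - d) / (2 * (1 - \<rho>)) / B \<le> relative_regret M \<theta> \<rho> d"
proof -
  have "expected_fb_npv M \<theta> \<rho> d = (\<rho> - d) / (2 * (1 - \<rho>))"
    using assms by (intro expected_fb_npv_uniform) auto
  moreover have "(\<rho> - d) / (2 * (1 - \<rho>)) / B \<le> (\<rho> - d) / (2 * (1 - \<rho>)) / optimal_npv M \<theta> \<rho> d"
    using optimal_npv_pos[OF assms(1-4)] le assms by (intro divide_left_mono mult_pos_pos) auto
  ultimately show ?thesis
    by (simp add: relative_regret_def)
qed

lemma relative_regret_ge_2:
  assumes "uniform01 M \<theta>" "0 \<le> d" "d < \<rho>" "\<rho> < 1"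
  shows "2 \<le> relative_regret M \<theta> \<rho> d"
proof -
  have "optimal_npv M \<theta> \<rho> d \<le> (\<rho> - d) / (4 * (1 - \<rho>))"
    using assms by (intro optimal_npv_le suminf_period_profit_le_quarter) auto
  from relative_regret_ge[OF assms this]
  have "(\<rho> - d) / (2 * (1 - \<rho>)) / ((\<rho> - d) / (4 * (1 - \<rho>))) \<le> relative_regret M \<theta> \<rho> d" .
  moreover have "(\<rho> - d) / (2 * (1 - \<rho>)) / ((\<rho> - d) / (4 * (1 - \<rho>))) = 2"
    using assms by (simp add: divide_simps)
  ultimately show ?thesis
    by simp
qed

text \<open>For fixed \<open>\<rho>\<close> this bound tends to infinity as \<open>d\<close>
  approaches \<open>\<rho>\<close>, which gives the unboundedness.\<close>

lemma relative_regret_ge_inverse: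
  assumes "uniform01 M \<theta>" "0 \<le> d" "d < \<rho>" "\<rho> < 1"
  shows "\<rho> * (1 - \<rho>) / (\<rho> - d) \<le> relative_regret M \<theta> \<rho> d"
proof -
  have "optimal_npv M \<theta> \<rho> d \<le> (\<rho> - d)\<^sup>2 / (2 * \<rho> * (1 - \<rho>)\<^sup>2)"
    using assms by (intro optimal_npv_le suminf_period_profit_le_square) auto
  from relative_regret_ge[OF assms this]
  have "(\<rho> - d) / (2 * (1 - \<rho>)) / ((\<rho> - d)\<^sup>2 / (2 * \<rho> * (1 - \<rho>)\<^sup>2)) \<le> relative_regret M \<theta> \<rho> d" .
  moreover have "(\<rho> - d) / (2 * (1 - \<rho>)) / ((\<rho> - d)\<^sup>2 / (2 * \<rho> * (1 - \<rho>)\<^sup>2)) = \<rho> * (1 - \<rho>) / (\<rho> - d)"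
    using assms by (simp add: divide_simps power2_eq_square)
  ultimately show ?thesis
    by simp
qed

end

theorem proposition5p2:
  fixes M :: "'a measure" and \<theta> :: "'a \<Rightarrow> real"
  assumes "prob_space M"
    and "distributed M lborel \<theta> (\<lambda>x. indicator {0..1} x / measure lborel {0..1::real})"
  shows "(\<forall>\<rho> d. 0 < d \<and> d < \<rho> \<and> \<rho> < 1 \<longrightarrow> relative_regret M \<theta> \<rho> d \<ge> 2)
       \<and> (\<forall>K>0. \<exists>\<rho> d. 0 < d \<and> d < \<rho> \<and> \<rho> < 1 \<and> relative_regret M \<theta> \<rho> d > K)"
proof (intro conjI allI impI)
  fix \<rho> d :: real
  assume "0 < d \<and> d < \<rho> \<and> \<rho> < 1"
  then show "relative_regret M \<theta> \<rho> d \<ge> 2"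
    using prob_space.relative_regret_ge_2[OF assms, of d \<rho>] by simp
next
  fix K :: real
  assume K: "0 < K"
  \<comment> \<open>With \<open>\<rho> = 1 / 2\<close> and \<open>d = 1 / 2 - e\<close> the inverse
    bound equals \<open>1 / (4 * e)\<close>, and this \<open>e\<close> makes it
    \<open>K + 1\<close>.\<close>
  define e where "e = 1 / (4 * (K + 1))"
  have e: "0 < e" "e < 1 / 2"
    using K by (auto simp: e_def field_simps)
  have "1 / 2 * (1 - 1 / 2) / e = K + 1"
    using K by (simp add: e_def)
  then have "K < relative_regret M \<theta> (1 / 2) (1 / 2 - e)"
    using prob_space.relative_regret_ge_inverse[OF assms, of "1 / 2 - e" "1 / 2"] e by simp
  then show "\<exists>\<rho> d. 0 < d \<and> d < \<rho> \<and> \<rho> < 1 \<and> relative_regret M \<theta> \<rho> d > K"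
    using e by (intro exI[of _ "1 / 2"] exI[of _ "1 / 2 - e"]) simp
qed

end
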